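(* The variety $\mathsf V(\mathbf C_4)$ generated by the (noncommutative) four-element idempotent residuated chain $\mathbf C_4$ has the amalgamation property.
   Context: A residuated lattice is an algebra $\mathbf A=\langle A,\wedge,\vee,\cdot,\backslash,/,\mathrm e\rangle$ such that $\langle A,\wedge,\vee\rangle$ is a lattice, $\langle A,\cdot,\mathrm e\rangle$ is a monoid, and for all $a,b,c\in A$: $b\le a\backslash c\iff a\cdot b\le c\iff a\le c/b$. $\mathbf C_4$ is the residuated lattice with universe $\{\bot,c,\mathrm e,c^\sharp\}$, lattice order the chain $\bot<c<\mathrm e<c^\sharp$, identity $\mathrm e$, and product given by $x\cdot\bot=\bot\cdot x=\bot$ for all $x$, $c\cdot c=c$, $c^\sharp\cdot c^\sharp=c^\sharp$, $c\cdot c^\sharp=c$, $c^\sharp\cdot c=c^\sharp$; the residuals are determined by the product and the order. A class $\mathsf K$ of algebras has the amalgamation property if for all $\mathbf A,\mathbf B,\mathbf C\in\mathsf K$ and embeddings $i_1\colon\mathbf A\to\mathbf B$, $i_2\colon\mathbf A\to\mathbf C$, there exist $\mathbf D\in\mathsf K$ and embeddings $j_1\colon\mathbf B\to\mathbf D$, $j_2\colon\mathbf C\to\mathbf D$ with $j_1\circ i_1=j_2\circ i_2$. *)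

theory Defs
  imports "HOL-Algebra.Group"
begin

section \<open>Residuated lattices\<close>

text \<open>The lattice operations are primitive operations of the signature (not derived from an order),
  since homomorphisms, identities and varieties refer to them. Values of the operations outside the
  carrier are irrelevant.\<close>

record 'a rl_algebra = "'a monoid" +
  rl_meet :: "'a \<Rightarrow> 'a \<Rightarrow> 'a"
  rl_join :: "'a \<Rightarrow> 'a \<Rightarrow> 'a"
  rl_under :: "'a \<Rightarrow> 'a \<Rightarrow> 'a"  \<comment> \<open>\<open>rl_under A a c\<close> is \<open>a \ c\<close>\<close>
  rl_over :: "'a \<Rightarrow> 'a \<Rightarrow> 'a"   \<comment> \<open>\<open>rl_over A c b\<close> is \<open>c / b\<close>\<close>

definition rl_le :: "'a rl_algebra \<Rightarrow> 'a \<Rightarrow> 'a \<Rightarrow> bool" where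
  "rl_le A a b \<longleftrightarrow> rl_meet A a b = a"

locale residuated_lattice = monoid A for A :: "'a rl_algebra" +
  assumes meet_closed: "\<lbrakk>a \<in> carrier A; b \<in> carrier A\<rbrakk> \<Longrightarrow> rl_meet A a b \<in> carrier A"
    and join_closed: "\<lbrakk>a \<in> carrier A; b \<in> carrier A\<rbrakk> \<Longrightarrow> rl_join A a b \<in> carrier A"
    and under_closed: "\<lbrakk>a \<in> carrier A; b \<in> carrier A\<rbrakk> \<Longrightarrow> rl_under A a b \<in> carrier A"
    and over_closed: "\<lbrakk>a \<in> carrier A; b \<in> carrier A\<rbrakk> \<Longrightarrow> rl_over A a b \<in> carrier A"
    and meet_comm: "\<lbrakk>a \<in> carrier A; b \<in> carrier A\<rbrakk> \<Longrightarrow> rl_meet A a b = rl_meet A b a"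
    and join_comm: "\<lbrakk>a \<in> carrier A; b \<in> carrier A\<rbrakk> \<Longrightarrow> rl_join A a b = rl_join A b a"
    and meet_assoc: "\<lbrakk>a \<in> carrier A; b \<in> carrier A; c \<in> carrier A\<rbrakk>
      \<Longrightarrow> rl_meet A (rl_meet A a b) c = rl_meet A a (rl_meet A b c)"
    and join_assoc: "\<lbrakk>a \<in> carrier A; b \<in> carrier A; c \<in> carrier A\<rbrakk>
      \<Longrightarrow> rl_join A (rl_join A a b) c = rl_join A a (rl_join A b c)"
    and meet_join_absorb: "\<lbrakk>a \<in> carrier A; b \<in> carrier A\<rbrakk> \<Longrightarrow> rl_meet A a (rl_join A a b) = a"
    and join_meet_absorb: "\<lbrakk>a \<in> carrier A; b \<in> carrier A\<rbrakk> \<Longrightarrow> rl_join A a (rl_meet A a b) = a"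
    and under_residual: "\<lbrakk>a \<in> carrier A; b \<in> carrier A; c \<in> carrier A\<rbrakk>
      \<Longrightarrow> rl_le A b (rl_under A a c) \<longleftrightarrow> rl_le A (a \<otimes>\<^bsub>A\<^esub> b) c"
    and over_residual: "\<lbrakk>a \<in> carrier A; b \<in> carrier A; c \<in> carrier A\<rbrakk>
      \<Longrightarrow> rl_le A (a \<otimes>\<^bsub>A\<^esub> b) c \<longleftrightarrow> rl_le A a (rl_over A c b)"

definition rl_hom :: "'a rl_algebra \<Rightarrow> 'b rl_algebra \<Rightarrow> ('a \<Rightarrow> 'b) set" where
  "rl_hom A B = {h \<in> hom A B. h \<one>\<^bsub>A\<^esub> = \<one>\<^bsub>B\<^esub> \<and>
     (\<forall>x\<in>carrier A. \<forall>y\<in>carrier A.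
        h (rl_meet A x y) = rl_meet B (h x) (h y) \<and>
        h (rl_join A x y) = rl_join B (h x) (h y) \<and>
        h (rl_under A x y) = rl_under B (h x) (h y) \<and>
        h (rl_over A x y) = rl_over B (h x) (h y))}"

definition rl_embedding :: "'a rl_algebra \<Rightarrow> 'b rl_algebra \<Rightarrow> ('a \<Rightarrow> 'b) set" where
  "rl_embedding A B = {h \<in> rl_hom A B. inj_on h (carrier A)}"

section \<open>Identities and generated varieties\<close>

datatype 'v rl_term =
    Var 'v
  | One
  | Meet "'v rl_term" "'v rl_term"
  | Join "'v rl_term" "'v rl_term"
  | Mult "'v rl_term" "'v rl_term"
  | Under "'v rl_term" "'v rl_term"
  | Over "'v rl_term" "'v rl_term"

primrec rl_eval :: "'a rl_algebra \<Rightarrow> ('v \<Rightarrow> 'a) \<Rightarrow> 'v rl_term \<Rightarrow> 'a" where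
  "rl_eval A v (Var x) = v x"
| "rl_eval A v One = \<one>\<^bsub>A\<^esub>"
| "rl_eval A v (Meet s t) = rl_meet A (rl_eval A v s) (rl_eval A v t)"
| "rl_eval A v (Join s t) = rl_join A (rl_eval A v s) (rl_eval A v t)"
| "rl_eval A v (Mult s t) = rl_eval A v s \<otimes>\<^bsub>A\<^esub> rl_eval A v t"
| "rl_eval A v (Under s t) = rl_under A (rl_eval A v s) (rl_eval A v t)"
| "rl_eval A v (Over s t) = rl_over A (rl_eval A v s) (rl_eval A v t)"

type_synonym rl_identity = "nat rl_term \<times> nat rl_term"

definition rl_models :: "'a rl_algebra \<Rightarrow> rl_identity set \<Rightarrow> bool" where
  "rl_models A E \<longleftrightarrow>
     (\<forall>(s, t) \<in> E. \<forall>v. range v \<subseteq> carrier A \<longrightarrow> rl_eval A v s = rl_eval A v t)"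

text \<open>A variety is the class of all residuated lattices that satisfy some set \<open>E\<close> of identities.
  The variety generated by \<open>G\<close> is the least variety containing \<open>G\<close>: its members are the algebras
  that lie in every variety containing \<open>G\<close>. Quantifying over \<open>E\<close> instead of over classes allows
  the members to live on a type \<open>'a\<close> different from that of \<open>G\<close>.\<close>

definition variety_generated_by :: "'g rl_algebra \<Rightarrow> 'a rl_algebra set" where
  "variety_generated_by G =
     {A. residuated_lattice A \<and> (\<forall>E. rl_models G E \<longrightarrow> rl_models A E)}"

section \<open>The amalgamation property\<close>

text \<open>Here \<open>K\<close> consists of the members of a class with carrier a subset of a fixed type \<open>'u\<close>.
  A variety in a countable signature has the amalgamation property iff, for every infinite type
  \<open>'u\<close>, its part on \<open>'u\<close> does: the members \<open>A\<close>, \<open>B\<close>, \<open>C\<close> have isomorphic copies on any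
  sufficiently large type, and an amalgam \<open>D\<close> can be replaced by its subalgebra generated by the
  images of \<open>B\<close> and \<open>C\<close>, whose cardinality is at most that of \<open>'u\<close> when \<open>'u\<close> is infinite.
  For finite \<open>'u\<close> the definition would restrict the size of the amalgam.\<close>

definition amalgamation_property :: "'u rl_algebra set \<Rightarrow> bool" where
  "amalgamation_property K \<longleftrightarrow>
     (\<forall>A\<in>K. \<forall>B\<in>K. \<forall>C\<in>K. \<forall>i1\<in>rl_embedding A B. \<forall>i2\<in>rl_embedding A C.
        \<exists>D\<in>K. \<exists>j1\<in>rl_embedding B D. \<exists>j2\<in>rl_embedding C D.
          \<forall>x\<in>carrier A. j1 (i1 x) = j2 (i2 x))"

section \<open>The four-element chain\<close>

datatype c4 = Bot | Cc | Ee | Cs  \<comment> \<open>\<open>\<bottom>\<close>, \<open>c\<close>, \<open>e\<close> and \<open>c\<^sup>\<sharp>\<close>\<close>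

primrec c4_rank :: "c4 \<Rightarrow> nat" where
  "c4_rank Bot = 0"
| "c4_rank Cc = 1"
| "c4_rank Ee = 2"
| "c4_rank Cs = 3"

instantiation c4 :: linorder
begin

definition less_eq_c4 :: "c4 \<Rightarrow> c4 \<Rightarrow> bool" where
  "less_eq_c4 x y \<longleftrightarrow> c4_rank x \<le> c4_rank y"

definition less_c4 :: "c4 \<Rightarrow> c4 \<Rightarrow> bool" where
  "less_c4 x y \<longleftrightarrow> c4_rank x < c4_rank y"

instance
proof
  fix x y :: c4
  show "x \<le> y \<Longrightarrow> y \<le> x \<Longrightarrow> x = y"
    by (cases x; cases y) (simp_all add: less_eq_c4_def)
qed (auto simp: less_eq_c4_def less_c4_def)

end

fun c4_mult :: "c4 \<Rightarrow> c4 \<Rightarrow> c4" where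
  "c4_mult Ee y = y"
| "c4_mult x Ee = x"
| "c4_mult Bot y = Bot"
| "c4_mult x Bot = Bot"
| "c4_mult Cc Cc = Cc"
| "c4_mult Cs Cs = Cs"
| "c4_mult Cc Cs = Cc"
| "c4_mult Cs Cc = Cs"

definition C4 :: "c4 rl_algebra" where
  "C4 = \<lparr>carrier = UNIV, mult = c4_mult, one = Ee,
     rl_meet = min, rl_join = max,
     rl_under = (\<lambda>a c. Max {b. c4_mult a b \<le> c}),
     rl_over = (\<lambda>c b. Max {a. c4_mult a b \<le> c})\<rparr>"

lemma UNIV_c4: "(UNIV :: c4 set) = {Bot, Cc, Ee, Cs}"
  using c4.exhaust by auto

instance c4 :: finite
  by standard (simp add: UNIV_c4)

lemma c4_mult_assoc: "c4_mult (c4_mult x y) z = c4_mult x (c4_mult y z)"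
  by (cases x; cases y; cases z) simp_all

lemma c4_mult_bot [simp]: "c4_mult Bot x = Bot" "c4_mult x Bot = Bot"
  by (cases x; simp)+

lemma c4_bot_le [simp]: "Bot \<le> x"
  by (simp add: less_eq_c4_def)

lemma c4_mult_mono: "x \<le> x' \<Longrightarrow> y \<le> y' \<Longrightarrow> c4_mult x y \<le> c4_mult x' y'"
  by (cases x; cases x'; cases y; cases y') (simp_all add: less_eq_c4_def)

lemma c4_residual:
  "b \<le> Max {b. c4_mult a b \<le> c} \<longleftrightarrow> c4_mult a b \<le> c"
  "a \<le> Max {a. c4_mult a b \<le> c} \<longleftrightarrow> c4_mult a b \<le> c"
proof -
  have ne: "{b. c4_mult a b \<le> c} \<noteq> {}" "{a. c4_mult a b \<le> c} \<noteq> {}"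
    by (auto intro: exI[of _ Bot])
  show "b \<le> Max {b. c4_mult a b \<le> c} \<longleftrightarrow> c4_mult a b \<le> c"
    using ne by (auto simp: Max_ge_iff intro: order.trans[OF c4_mult_mono])
  show "a \<le> Max {a. c4_mult a b \<le> c} \<longleftrightarrow> c4_mult a b \<le> c"
    using ne by (auto simp: Max_ge_iff intro: order.trans[OF c4_mult_mono])
qed

lemma residuated_lattice_C4: "residuated_lattice C4"
proof -
  have le: "rl_le C4 x y \<longleftrightarrow> x \<le> y" for x y
    by (auto simp: rl_le_def C4_def min_def)
  have one: "c4_mult x Ee = x" for x
    by (cases x) simp_all
  show ?thesis
    by unfold_locales
      (simp_all add: le, simp_all add: C4_def c4_mult_assoc one c4_residual ac_simps)
qed

lemma C4_in_variety: "C4 \<in> variety_generated_by C4"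
  by (simp add: variety_generated_by_def residuated_lattice_C4)

end

theory Submission
  imports Defs
begin

text \<open>There are terms \<open>eq(x, y)\<close>, with value \<open>e\<close> in \<open>C4\<close> if \<open>x = y\<close> and \<open>\<bottom>\<close> otherwise, and
  \<open>\<kappa>\<^sub>q(z)\<close>, with value \<open>q\<close> at \<open>z = \<bottom>\<close> and \<open>e\<close> at \<open>z = e\<close>. If \<open>P\<close> is a prime filter of the lattice of
  a member \<open>A\<close> of the variety with \<open>e \<in> P\<close> and \<open>z = eq(a, b) \<notin> P\<close>, then mapping \<open>x\<close> to the unique \<open>q\<close> with
  \<open>eq(x, \<kappa>\<^sub>q(z)) \<in> P\<close> is a homomorphism \<open>A \<rightarrow> C4\<close>, because all facts needed are identities of \<open>C4\<close>. The
  prime filter theorem then shows that homomorphisms to \<open>C4\<close> separate points and extend along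
  embeddings. Hence the pairs of homomorphisms \<open>B \<rightarrow> C4\<close> and \<open>C \<rightarrow> C4\<close> that agree on \<open>A\<close> embed
  \<open>B\<close> and \<open>C\<close> compatibly into a power of \<open>C4\<close>. The subalgebra generated by the images has at most
  as many elements as there are terms in the elements of \<open>B\<close> and \<open>C\<close>, so it fits on an infinite
  type.\<close>

section \<open>Prime filters of a residuated lattice\<close>

context residuated_lattice
begin

abbreviation le (infix "\<preceq>" 50) where "x \<preceq> y \<equiv> rl_le A x y"

section \<open>Order laws derived from the lattice identities\<close>

lemma meet_idem: "x \<in> carrier A \<Longrightarrow> rl_meet A x x = x"
  by (metis join_meet_absorb meet_closed meet_join_absorb)

lemma le_refl: "x \<in> carrier A \<Longrightarrow> x \<preceq> x"
  by (simp add: rl_le_def meet_idem)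

lemma le_trans:
  "\<lbrakk>x \<preceq> y; y \<preceq> z; x \<in> carrier A; y \<in> carrier A; z \<in> carrier A\<rbrakk> \<Longrightarrow> x \<preceq> z"
  unfolding rl_le_def by (metis meet_assoc)

lemma le_antisym: "\<lbrakk>x \<preceq> y; y \<preceq> x; x \<in> carrier A; y \<in> carrier A\<rbrakk> \<Longrightarrow> x = y"
  unfolding rl_le_def by (metis meet_comm)

lemma meet_le1: "\<lbrakk>x \<in> carrier A; y \<in> carrier A\<rbrakk> \<Longrightarrow> rl_meet A x y \<preceq> x"
  unfolding rl_le_def by (metis meet_assoc meet_comm meet_idem)

lemma meet_le2: "\<lbrakk>x \<in> carrier A; y \<in> carrier A\<rbrakk> \<Longrightarrow> rl_meet A x y \<preceq> y"
  by (metis meet_le1 meet_comm)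

lemma le_meetI:
  "\<lbrakk>x \<preceq> y; x \<preceq> z; x \<in> carrier A; y \<in> carrier A; z \<in> carrier A\<rbrakk> \<Longrightarrow> x \<preceq> rl_meet A y z"
  unfolding rl_le_def by (metis meet_assoc)

lemma le_iff_join: "\<lbrakk>x \<in> carrier A; y \<in> carrier A\<rbrakk> \<Longrightarrow> x \<preceq> y \<longleftrightarrow> rl_join A x y = y"
  unfolding rl_le_def by (metis join_comm join_meet_absorb meet_comm meet_join_absorb)

lemma le_join1: "\<lbrakk>x \<in> carrier A; y \<in> carrier A\<rbrakk> \<Longrightarrow> x \<preceq> rl_join A x y"
  unfolding rl_le_def by (rule meet_join_absorb)

lemma le_join2: "\<lbrakk>x \<in> carrier A; y \<in> carrier A\<rbrakk> \<Longrightarrow> y \<preceq> rl_join A x y"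
  by (metis le_join1 join_comm)

lemma join_leI:
  "\<lbrakk>x \<preceq> z; y \<preceq> z; x \<in> carrier A; y \<in> carrier A; z \<in> carrier A\<rbrakk> \<Longrightarrow> rl_join A x y \<preceq> z"
  by (metis le_iff_join join_assoc join_closed)

section \<open>Lattice filters and the prime filter theorem\<close>

definition lattice_filter :: "'a set \<Rightarrow> bool" where
  "lattice_filter F \<longleftrightarrow> F \<subseteq> carrier A \<and> F \<noteq> {} \<and> (\<forall>x\<in>F. \<forall>y\<in>F. rl_meet A x y \<in> F) \<and>
     (\<forall>x\<in>F. \<forall>y\<in>carrier A. x \<preceq> y \<longrightarrow> y \<in> F)"

definition prime_filter :: "'a set \<Rightarrow> bool" where
  "prime_filter P \<longleftrightarrow> lattice_filter P \<and>
     (\<forall>x\<in>carrier A. \<forall>y\<in>carrier A. rl_join A x y \<in> P \<longrightarrow> x \<in> P \<or> y \<in> P)"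

text \<open>\<open>G\<close> is the filter generated by \<open>P\<close> and \<open>x\<close>. It is
  closed under meets because the meet of \<open>p\<close>, \<open>q\<close> and \<open>x\<close>
  lies below those of \<open>p\<close> and \<open>q\<close> with \<open>x\<close>.\<close>

lemma lattice_filter_adjoin:
  assumes "lattice_filter P" "x \<in> carrier A"
  defines "G \<equiv> {u \<in> carrier A. \<exists>p\<in>P. rl_meet A p x \<preceq> u}"
  shows "lattice_filter G" "P \<subseteq> G" "x \<in> G"
proof -
  have P: "P \<subseteq> carrier A" "P \<noteq> {}" "\<And>p q. p \<in> P \<Longrightarrow> q \<in> P \<Longrightarrow> rl_meet A p q \<in> P"
    using assms(1) unfolding lattice_filter_def by auto
  show "P \<subseteq> G"
    unfolding G_def using P(1) assms(2) meet_le1 by blast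
  show "x \<in> G"
    unfolding G_def using P(1,2) assms(2) meet_le2 by blast
  have "rl_meet A u v \<in> G" if "u \<in> G" "v \<in> G" for u v
  proof -
    obtain p q where pq: "p \<in> P" "q \<in> P" "rl_meet A p x \<preceq> u" "rl_meet A q x \<preceq> v"
      using \<open>u \<in> G\<close> \<open>v \<in> G\<close> unfolding G_def by blast
    have c: "p \<in> carrier A" "q \<in> carrier A" "u \<in> carrier A" "v \<in> carrier A"
      using pq(1,2) P(1) that unfolding G_def by auto
    let ?r = "rl_meet A (rl_meet A p q) x"
    have r: "?r \<in> carrier A" "rl_meet A p q \<in> carrier A"
      using c assms(2) by (auto intro: meet_closed)
    have "?r \<preceq> rl_meet A p q" "?r \<preceq> x"
      using r assms(2) by (auto intro: meet_le1 meet_le2)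
    hence "?r \<preceq> p" "?r \<preceq> q"
      using r c meet_le1[of p q] meet_le2[of p q] le_trans[of ?r "rl_meet A p q"] by blast+
    hence "?r \<preceq> rl_meet A p x" "?r \<preceq> rl_meet A q x"
      using \<open>?r \<preceq> x\<close> r c assms(2) by (auto intro: le_meetI)
    hence "?r \<preceq> u" "?r \<preceq> v"
      using pq(3,4) r c assms(2) le_trans[of ?r] meet_closed by blast+
    hence "?r \<preceq> rl_meet A u v"
      using r c by (auto intro: le_meetI)
    thus ?thesis
      unfolding G_def using P(3)[OF pq(1,2)] c by (auto intro: meet_closed)
  qed
  moreover have "v \<in> G" if "u \<in> G" "v \<in> carrier A" "u \<preceq> v" for u v
  proof -
    obtain p where p: "p \<in> P" "rl_meet A p x \<preceq> u" and u: "u \<in> carrier A"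
      using \<open>u \<in> G\<close> unfolding G_def by blast
    have "rl_meet A p x \<in> carrier A"
      using p(1) P(1) assms(2) meet_closed by blast
    hence "rl_meet A p x \<preceq> v"
      using p(2) that(2,3) u le_trans by blast
    thus ?thesis
      unfolding G_def using p(1) that(2) by blast
  qed
  ultimately show "lattice_filter G"
    unfolding lattice_filter_def using \<open>x \<in> G\<close> by (auto simp: G_def)
qed

text \<open>Zorn's lemma gives a filter maximal among those containing \<open>F\<close> and avoiding
  \<open>J\<close>; distributivity makes it prime. \<open>J\<close> is a join-closed set instead of
  an ideal, so that an image under an embedding can be used directly.\<close>

theorem prime_filter_exists:
  assumes distrib: "\<And>x y z. \<lbrakk>x \<in> carrier A; y \<in> carrier A; z \<in> carrier A\<rbrakk>
      \<Longrightarrow> rl_meet A x (rl_join A y z) = rl_join A (rl_meet A x y) (rl_meet A x z)"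
    and F: "lattice_filter F" and J: "J \<subseteq> carrier A" "F \<inter> J = {}"
    and J_join: "\<And>x y. \<lbrakk>x \<in> J; y \<in> J\<rbrakk> \<Longrightarrow> rl_join A x y \<in> J"
  obtains P where "prime_filter P" "F \<subseteq> P" "P \<inter> J = {}"
proof -
  define \<F> where "\<F> = {G. lattice_filter G \<and> F \<subseteq> G \<and> G \<inter> J = {}}"
  have "\<exists>M\<in>\<F>. \<forall>X\<in>\<F>. M \<subseteq> X \<longrightarrow> X = M"
  proof (rule subset_Zorn_nonempty)
    show "\<F> \<noteq> {}"
      using F J(2) unfolding \<F>_def by blast
  next
    fix \<C> assume ne: "\<C> \<noteq> {}" and ch: "subset.chain \<F> \<C>"
    have sub: "\<C> \<subseteq> \<F>"
      using ch by (simp add: subset_chain_def)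
    have mem: "lattice_filter X" "F \<subseteq> X" "X \<inter> J = {}" if "X \<in> \<C>" for X
      using that sub unfolding \<F>_def by auto
    have "rl_meet A x y \<in> \<Union>\<C>" if xy: "x \<in> X" "X \<in> \<C>" "y \<in> Y" "Y \<in> \<C>" for x X y Y
    proof -
      have "X \<subseteq> Y \<or> Y \<subseteq> X"
        using ch xy by (auto simp: subset_chain_def)
      moreover have "lattice_filter X" "lattice_filter Y"
        using mem(1) xy by auto
      ultimately have "rl_meet A x y \<in> X \<or> rl_meet A x y \<in> Y"
        using xy unfolding lattice_filter_def by (meson subsetD)
      thus ?thesis
        using xy by blast
    qed
    moreover have "y \<in> \<Union>\<C>" if "x \<in> X" "X \<in> \<C>" "y \<in> carrier A" "x \<preceq> y" for x X y
    proof -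
      have "y \<in> X"
        using that mem(1) unfolding lattice_filter_def by blast
      thus ?thesis
        using that by blast
    qed
    moreover have "\<Union>\<C> \<subseteq> carrier A"
      using mem(1) unfolding lattice_filter_def by blast
    moreover have "F \<subseteq> \<Union>\<C>" "\<Union>\<C> \<inter> J = {}"
      using ne mem(2,3) by blast+
    moreover have "\<Union>\<C> \<noteq> {}"
      using \<open>F \<subseteq> \<Union>\<C>\<close> F unfolding lattice_filter_def by blast
    ultimately show "\<Union>\<C> \<in> \<F>"
      unfolding \<F>_def lattice_filter_def by simp
  qed
  then obtain P where P: "P \<in> \<F>" and max: "\<And>X. X \<in> \<F> \<Longrightarrow> P \<subseteq> X \<Longrightarrow> X = P"
    by blast
  have flt: "lattice_filter P" "F \<subseteq> P" "P \<inter> J = {}"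
    using P unfolding \<F>_def by auto
  hence Pc: "P \<subseteq> carrier A"
    unfolding lattice_filter_def by blast
  \<comment> \<open>By maximality, the filter generated by \<open>P\<close> and an element outside
    \<open>P\<close> meets \<open>J\<close>.\<close>
  have meets: "\<exists>p\<in>P. \<exists>j\<in>J. rl_meet A p x \<preceq> j" if "x \<in> carrier A" "x \<notin> P" for x
  proof -
    let ?G = "{u \<in> carrier A. \<exists>p\<in>P. rl_meet A p x \<preceq> u}"
    note G = lattice_filter_adjoin[OF flt(1) that(1)]
    have "?G \<notin> \<F>"
      using max[of ?G] G(2,3) that(2) by blast
    thus ?thesis
      using G(1,2) flt(2) unfolding \<F>_def by blast
  qed
  have "x \<in> P \<or> y \<in> P"
    if x: "x \<in> carrier A" and y: "y \<in> carrier A" and xy: "rl_join A x y \<in> P" for x y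
  proof (rule ccontr)
    assume "\<not> (x \<in> P \<or> y \<in> P)"
    then obtain p q j k where pq: "p \<in> P" "q \<in> P" "j \<in> J" "k \<in> J"
      and le: "rl_meet A p x \<preceq> j" "rl_meet A q y \<preceq> k"
      using meets x y by metis
    have c: "p \<in> carrier A" "q \<in> carrier A" "j \<in> carrier A" "k \<in> carrier A"
      using pq Pc J(1) by auto
    \<comment> \<open>\<open>r\<close> and \<open>l\<close> serve for \<open>x\<close> and
      \<open>y\<close> at once. Distributivity then puts the meet of \<open>r\<close> with the join
      of \<open>x\<close> and \<open>y\<close>, an element of \<open>P\<close>, below
      \<open>l\<close>, an element of \<open>J\<close>.\<close>
    define r where "r = rl_meet A p q"
    define l where "l = rl_join A j k"
    have r: "r \<in> P" "r \<in> carrier A"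
      using flt(1) pq c meet_closed unfolding lattice_filter_def r_def by auto
    have l: "l \<in> J" "l \<in> carrier A"
      using J_join pq c join_closed unfolding l_def by auto
    have mono: "rl_meet A r z \<preceq> l"
      if "z \<in> carrier A" "s \<in> carrier A" "r \<preceq> s" "rl_meet A s z \<preceq> i" "i \<in> carrier A" "i \<preceq> l"
      for s i z
    proof -
      have rz: "rl_meet A r z \<in> carrier A" "rl_meet A s z \<in> carrier A"
        using that r meet_closed by auto
      have "rl_meet A r z \<preceq> rl_meet A s z"
        using that rz r le_trans[OF meet_le1[of r z] \<open>r \<preceq> s\<close>] by (auto intro: le_meetI meet_le2)
      thus ?thesis
        using that rz l le_trans by blast
    qed
    have "rl_meet A r x \<preceq> l"
      by (rule mono[of x p j]) (use x c le in \<open>auto simp: r_def l_def intro: meet_le1 le_join1\<close>)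
    moreover have "rl_meet A r y \<preceq> l"
      by (rule mono[of y q k]) (use y c le in \<open>auto simp: r_def l_def intro: meet_le2 le_join2\<close>)
    ultimately have "rl_meet A r (rl_join A x y) \<preceq> l"
      using distrib[of r x y] x y r l meet_closed by (auto intro: join_leI)
    moreover have "rl_meet A r (rl_join A x y) \<in> P"
      using flt(1) r xy unfolding lattice_filter_def by blast
    ultimately have "l \<in> P"
      using flt(1) l unfolding lattice_filter_def by blast
    thus False
      using l flt(3) by blast
  qed
  hence "prime_filter P"
    unfolding prime_filter_def using flt(1) by blast
  thus ?thesis
    using that flt by blast
qed

end

section \<open>Operations of the four-element chain\<close>

text \<open>Makes the sets explicit whose maxima define the residuals of \<open>C4\<close>, so that
  simplification can evaluate them.\<close>

lemma c4_collect: "{x :: c4. P x} = set (filter P [Bot, Cc, Ee, Cs])"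
proof (rule Set.set_eqI)
  show "x \<in> {x. P x} \<longleftrightarrow> x \<in> set (filter P [Bot, Cc, Ee, Cs])" for x
    by (cases x) simp_all
qed

lemma C4_simps [simp]:
  "carrier C4 = UNIV" "mult C4 = c4_mult" "one C4 = Ee" "rl_meet C4 = min" "rl_join C4 = max"
  by (simp_all add: C4_def)

lemma c4_order [simp]:
  "Cc \<le> Ee" "Cc \<le> Cs" "Ee \<le> Cs" "x \<le> Cs" "\<not> Cc \<le> Bot" "\<not> Ee \<le> Bot" "\<not> Cs \<le> Bot"
  "\<not> Ee \<le> Cc" "\<not> Cs \<le> Cc" "\<not> Cs \<le> Ee"
  by (cases x; simp add: less_eq_c4_def)+

lemma C4_under [simp]:
  "rl_under C4 Bot y = Cs" "rl_under C4 Ee y = y"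
  "rl_under C4 Cc Bot = Bot" "rl_under C4 Cc Cc = Cs" "rl_under C4 Cc Ee = Cs" "rl_under C4 Cc Cs = Cs"
  "rl_under C4 Cs Bot = Bot" "rl_under C4 Cs Cc = Bot" "rl_under C4 Cs Ee = Bot" "rl_under C4 Cs Cs = Cs"
  by (cases y; simp add: C4_def c4_collect max_def)+

lemma C4_over [simp]:
  "rl_over C4 x Bot = Cs" "rl_over C4 x Ee = x"
  "rl_over C4 Bot Cc = Bot" "rl_over C4 Cc Cc = Ee" "rl_over C4 Ee Cc = Ee" "rl_over C4 Cs Cc = Cs"
  "rl_over C4 Bot Cs = Bot" "rl_over C4 Cc Cs = Cc" "rl_over C4 Ee Cs = Cc" "rl_over C4 Cs Cs = Cs"
  by (cases x; simp add: C4_def c4_collect max_def)+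

text \<open>In \<open>C4\<close>, \<open>w\<close> is \<open>Ee\<close> exactly if
  \<open>x = y\<close>. Otherwise \<open>w\<close> is \<open>Bot\<close> or \<open>Cc\<close>, so
  \<open>rl_under\<close> of \<open>w\<close> with itself is \<open>Cs\<close>, and the outer
  residual sends \<open>Cs\<close> to \<open>Bot\<close>.\<close>

definition rl_eq :: "'a rl_algebra \<Rightarrow> 'a \<Rightarrow> 'a \<Rightarrow> 'a" where
  "rl_eq A x y = (let w = rl_meet A (rl_meet A (rl_under A x y) (rl_under A y x)) \<one>\<^bsub>A\<^esub>
     in rl_under A (rl_under A w w) \<one>\<^bsub>A\<^esub>)"

lemma rl_eq_C4: "rl_eq C4 x y = (if x = y then Ee else Bot)"
  by (cases x; cases y; simp add: rl_eq_def min_def)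

text \<open>The signature names only the unit, so the elements of \<open>C4\<close> are expressed
  through a parameter \<open>z\<close>: at \<open>Bot\<close>, the residual of \<open>z\<close> by
  itself is the top \<open>Cs\<close>, and \<open>Ee\<close> over \<open>Cs\<close> is
  \<open>Cc\<close>.\<close>

primrec rl_const :: "'a rl_algebra \<Rightarrow> c4 \<Rightarrow> 'a \<Rightarrow> 'a" where
  "rl_const A Bot z = z"
| "rl_const A Cc z = rl_over A \<one>\<^bsub>A\<^esub> (rl_under A z z)"
| "rl_const A Ee z = \<one>\<^bsub>A\<^esub>"
| "rl_const A Cs z = rl_under A z z"

lemma rl_const_C4: "rl_const C4 q Ee = Ee" "rl_const C4 q Bot = q"
  by (cases q; simp)+

definition eq_term :: "'v rl_term \<Rightarrow> 'v rl_term \<Rightarrow> 'v rl_term" where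
  "eq_term s t = (let w = Meet (Meet (Under s t) (Under t s)) One in Under (Under w w) One)"

primrec const_term :: "c4 \<Rightarrow> 'v rl_term \<Rightarrow> 'v rl_term" where
  "const_term Bot t = t"
| "const_term Cc t = Over One (Under t t)"
| "const_term Ee t = One"
| "const_term Cs t = Under t t"

lemma eval_eq_term [simp]: "rl_eval A v (eq_term s t) = rl_eq A (rl_eval A v s) (rl_eval A v t)"
  by (simp add: eq_term_def rl_eq_def Let_def)

lemma eval_const_term [simp]: "rl_eval A v (const_term q t) = rl_const A q (rl_eval A v t)"
  by (cases q) simp_all

section \<open>Identities in the generated variety\<close>

lemma variety_identity:
  fixes s t :: "nat rl_term"
  assumes "A \<in> variety_generated_by G" "range v \<subseteq> carrier A"
    and "\<And>w. range w \<subseteq> carrier G \<Longrightarrow> rl_eval G w s = rl_eval G w t"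
  shows "rl_eval A v s = rl_eval A v t"
proof -
  have "rl_models G {(s, t)}"
    using assms(3) by (simp add: rl_models_def)
  hence "rl_models A {(s, t)}"
    using assms(1) by (simp add: variety_generated_by_def)
  thus ?thesis
    using assms(2) by (simp add: rl_models_def)
qed

locale C4_variety_member = residuated_lattice A for A :: "'a rl_algebra" +
  assumes in_variety: "A \<in> variety_generated_by C4"
begin

lemmas closed = meet_closed join_closed under_closed over_closed

lemma rl_eq_closed: "\<lbrakk>x \<in> carrier A; y \<in> carrier A\<rbrakk> \<Longrightarrow> rl_eq A x y \<in> carrier A"
  by (simp add: rl_eq_def Let_def closed)

lemma rl_const_closed: "z \<in> carrier A \<Longrightarrow> rl_const A q z \<in> carrier A"
  by (cases q) (simp_all add: closed)

text \<open>Variables 0, 1, 2 denote \<open>x\<close>, \<open>y\<close>, \<open>z\<close>; all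
  others take the default \<open>u\<close>, which keeps the valuation inside the carrier. With fewer
  variables an element is repeated.\<close>

lemma identity4:
  assumes "x \<in> carrier A" "y \<in> carrier A" "z \<in> carrier A" "u \<in> carrier A"
    and "\<And>w. rl_eval C4 w s = rl_eval C4 w t"
  defines "v \<equiv> \<lambda>n::nat. if n = 0 then x else if n = 1 then y else if n = 2 then z else u"
  shows "rl_eval A v s = rl_eval A v t"
  by (rule variety_identity[OF in_variety]) (use assms in auto)

text \<open>An inequality is the identity equating the meet of both sides with the left
  side.\<close>

lemma inequality4:
  assumes "x \<in> carrier A" "y \<in> carrier A" "z \<in> carrier A" "u \<in> carrier A"
    and "\<And>w. rl_eval C4 w s \<le> rl_eval C4 w t"
  defines "v \<equiv> \<lambda>n::nat. if n = 0 then x else if n = 1 then y else if n = 2 then z else u"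
  shows "rl_eval A v s \<preceq> rl_eval A v t"
  using identity4[OF assms(1-4), of "Meet s t" s] assms(5) unfolding rl_le_def v_def
  by (simp add: min_absorb1)

lemma distrib:
  assumes "x \<in> carrier A" "y \<in> carrier A" "z \<in> carrier A"
  shows "rl_meet A x (rl_join A y z) = rl_join A (rl_meet A x y) (rl_meet A x z)"
  using identity4[OF assms assms(3), of "Meet (Var 0) (Join (Var 1) (Var 2))"
      "Join (Meet (Var 0) (Var 1)) (Meet (Var 0) (Var 2))"]
  by (simp add: min_max_distrib2)

section \<open>Properties of the equality and constant terms\<close>

lemma rl_eq_self: "x \<in> carrier A \<Longrightarrow> rl_eq A x x = \<one>\<^bsub>A\<^esub>"
  using identity4[of x x x x "eq_term (Var 0) (Var 0)" One] by (simp add: rl_eq_C4)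

lemma rl_eq_sym: "\<lbrakk>x \<in> carrier A; y \<in> carrier A\<rbrakk> \<Longrightarrow> rl_eq A x y = rl_eq A y x"
  using identity4[of x y y y "eq_term (Var 0) (Var 1)" "eq_term (Var 1) (Var 0)"]
  by (simp add: rl_eq_C4 eq_commute)

lemma rl_eq_le_under: "\<lbrakk>x \<in> carrier A; y \<in> carrier A\<rbrakk> \<Longrightarrow> rl_eq A x y \<preceq> rl_under A x y"
proof -
  have "rl_eq C4 a b \<le> rl_under C4 a b" for a b
    by (cases a; cases b; simp add: rl_eq_C4)
  thus "\<lbrakk>x \<in> carrier A; y \<in> carrier A\<rbrakk> \<Longrightarrow> ?thesis"
    using inequality4[of x y y y "eq_term (Var 0) (Var 1)" "Under (Var 0) (Var 1)"] by simp
qed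

text \<open>An implication between equations does not transfer from \<open>C4\<close> as an
  identity; it follows from the inequality \<open>rl_eq_le_under\<close> by residuation.\<close>

lemma eq_if_rl_eq_one:
  assumes x: "x \<in> carrier A" and y: "y \<in> carrier A" and "rl_eq A x y = \<one>\<^bsub>A\<^esub>"
  shows "x = y"
proof -
  have "\<one>\<^bsub>A\<^esub> \<preceq> rl_under A x y" "\<one>\<^bsub>A\<^esub> \<preceq> rl_under A y x"
    using rl_eq_le_under[OF x y] rl_eq_le_under[OF y x] rl_eq_sym[OF x y] assms(3) by simp_all
  hence "x \<preceq> y" "y \<preceq> x"
    using under_residual[OF x one_closed y] under_residual[OF y one_closed x] x y by simp_all
  thus ?thesis
    using x y le_antisym by blast
qed

text \<open>In \<open>C4\<close>, \<open>w\<close> is \<open>Bot\<close> unless \<open>x = z\<close>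
  and \<open>y = u\<close>, and then the right sides are \<open>Ee\<close>.\<close>

lemma rl_eq_cong:
  assumes "x \<in> carrier A" "y \<in> carrier A" "z \<in> carrier A" "u \<in> carrier A"
  defines "w \<equiv> rl_meet A (rl_eq A x z) (rl_eq A y u)"
  shows "w \<preceq> rl_eq A (rl_meet A x y) (rl_meet A z u)"
    and "w \<preceq> rl_eq A (rl_join A x y) (rl_join A z u)"
    and "w \<preceq> rl_eq A (x \<otimes>\<^bsub>A\<^esub> y) (z \<otimes>\<^bsub>A\<^esub> u)"
    and "w \<preceq> rl_eq A (rl_under A x y) (rl_under A z u)"
    and "w \<preceq> rl_eq A (rl_over A x y) (rl_over A z u)"
proof -
  let ?s = "Meet (eq_term (Var 0) (Var 2)) (eq_term (Var 1) (Var 3))"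
  note le = inequality4[OF assms(1-4), where s = ?s]
  note s = rl_eq_C4 min_def w_def
  show "w \<preceq> rl_eq A (rl_meet A x y) (rl_meet A z u)"
    using le[of "eq_term (Meet (Var 0) (Var 1)) (Meet (Var 2) (Var 3))"] by (simp add: s)
  show "w \<preceq> rl_eq A (rl_join A x y) (rl_join A z u)"
    using le[of "eq_term (Join (Var 0) (Var 1)) (Join (Var 2) (Var 3))"] by (simp add: s)
  show "w \<preceq> rl_eq A (x \<otimes>\<^bsub>A\<^esub> y) (z \<otimes>\<^bsub>A\<^esub> u)"
    using le[of "eq_term (Mult (Var 0) (Var 1)) (Mult (Var 2) (Var 3))"] by (simp add: s)
  show "w \<preceq> rl_eq A (rl_under A x y) (rl_under A z u)"
    using le[of "eq_term (Under (Var 0) (Var 1)) (Under (Var 2) (Var 3))"] by (simp add: s)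
  show "w \<preceq> rl_eq A (rl_over A x y) (rl_over A z u)"
    using le[of "eq_term (Over (Var 0) (Var 1)) (Over (Var 2) (Var 3))"] by (simp add: s)
qed

text \<open>\<open>z\<close> is an equality term because this takes only two values in
  \<open>C4\<close>: at \<open>Bot\<close> the constants are the elements of \<open>C4\<close>
  themselves, at \<open>Ee\<close> they all collapse to the idempotent \<open>Ee\<close>.\<close>

lemma rl_const_ops:
  assumes "a \<in> carrier A" "b \<in> carrier A"
  defines "z \<equiv> rl_eq A a b"
  shows "rl_meet A (rl_const A p z) (rl_const A q z) = rl_const A (min p q) z"
    and "rl_join A (rl_const A p z) (rl_const A q z) = rl_const A (max p q) z"
    and "rl_const A p z \<otimes>\<^bsub>A\<^esub> rl_const A q z = rl_const A (c4_mult p q) z"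
    and "rl_under A (rl_const A p z) (rl_const A q z) = rl_const A (rl_under C4 p q) z"
    and "rl_over A (rl_const A p z) (rl_const A q z) = rl_const A (rl_over C4 p q) z"
proof -
  let ?z = "eq_term (Var 0) (Var 1)"
  note id = identity4[OF assms(1,2,2,2)]
  note s = rl_eq_C4 rl_const_C4 z_def
  show "rl_meet A (rl_const A p z) (rl_const A q z) = rl_const A (min p q) z"
    using id[of "Meet (const_term p ?z) (const_term q ?z)" "const_term (min p q) ?z"] by (simp add: s)
  show "rl_join A (rl_const A p z) (rl_const A q z) = rl_const A (max p q) z"
    using id[of "Join (const_term p ?z) (const_term q ?z)" "const_term (max p q) ?z"] by (simp add: s)
  show "rl_const A p z \<otimes>\<^bsub>A\<^esub> rl_const A q z = rl_const A (c4_mult p q) z"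
    using id[of "Mult (const_term p ?z) (const_term q ?z)" "const_term (c4_mult p q) ?z"]
    by (simp add: s)
  show "rl_under A (rl_const A p z) (rl_const A q z) = rl_const A (rl_under C4 p q) z"
    using id[of "Under (const_term p ?z) (const_term q ?z)" "const_term (rl_under C4 p q) ?z"]
    by (simp add: s)
  show "rl_over A (rl_const A p z) (rl_const A q z) = rl_const A (rl_over C4 p q) z"
    using id[of "Over (const_term p ?z) (const_term q ?z)" "const_term (rl_over C4 p q) ?z"]
    by (simp add: s)
qed

text \<open>In \<open>C4\<close>, either \<open>z\<close> is \<open>Ee\<close>, or it is
  \<open>Bot\<close> and \<open>x\<close> equals one of the four constants.\<close>

lemma rl_const_cover:
  assumes "x \<in> carrier A" "a \<in> carrier A" "b \<in> carrier A"
  defines "z \<equiv> rl_eq A a b"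
  shows "rl_join A z (rl_join A (rl_join A (rl_eq A x (rl_const A Bot z)) (rl_eq A x (rl_const A Cc z)))
    (rl_join A (rl_eq A x (rl_const A Ee z)) (rl_eq A x (rl_const A Cs z)))) = \<one>\<^bsub>A\<^esub>"
proof -
  let ?z = "eq_term (Var 1) (Var 2)"
  let ?e = "\<lambda>q. eq_term (Var 0) (const_term q ?z)"
  have "rl_eval C4 w (Join ?z (Join (Join (?e Bot) (?e Cc)) (Join (?e Ee) (?e Cs)))) =
      rl_eval C4 w One" for w
    by (cases "w 0") (simp_all add: rl_eq_C4 rl_const_C4 max_def del: rl_const.simps const_term.simps)
  from identity4[OF assms(1-3,3) this] show ?thesis
    by (simp add: z_def del: rl_const.simps const_term.simps)
qed

lemma rl_const_distinct:
  assumes "x \<in> carrier A" "a \<in> carrier A" "b \<in> carrier A" "p \<noteq> q"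
  defines "z \<equiv> rl_eq A a b"
  shows "rl_meet A (rl_eq A x (rl_const A p z)) (rl_eq A x (rl_const A q z)) \<preceq> z"
proof -
  let ?z = "eq_term (Var 1) (Var 2)"
  let ?e = "\<lambda>q. eq_term (Var 0) (const_term q ?z)"
  have "rl_eval C4 w (Meet (?e p) (?e q)) \<le> rl_eval C4 w ?z" for w
    using \<open>p \<noteq> q\<close> by (simp add: rl_eq_C4 rl_const_C4 min_def)
  from inequality4[OF assms(1-3,3) this] show ?thesis
    by (simp add: z_def)
qed


text \<open>Primeness and \<open>rl_const_cover\<close> give \<open>x\<close> a value;
  \<open>rl_const_distinct\<close> makes it unique because \<open>z\<close> is outside
  \<open>P\<close>. \<open>rl_eq_cong\<close> and \<open>rl_const_ops\<close> yield compatibility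
  with the operations.\<close>

lemma hom_of_prime_filter:
  assumes P: "prime_filter P" and one: "\<one>\<^bsub>A\<^esub> \<in> P" and ab: "a \<in> carrier A" "b \<in> carrier A"
  defines "z \<equiv> rl_eq A a b"
  assumes z: "z \<notin> P"
  obtains h where "h \<in> rl_hom A C4"
    and "\<And>x q. x \<in> carrier A \<Longrightarrow> h x = q \<longleftrightarrow> rl_eq A x (rl_const A q z) \<in> P"
proof -
  have zc: "z \<in> carrier A"
    unfolding z_def using ab by (rule rl_eq_closed)
  have up: "y \<in> P" if "x \<in> P" "y \<in> carrier A" "x \<preceq> y" for x y
    using P that unfolding prime_filter_def lattice_filter_def by blast
  have meet: "rl_meet A x y \<in> P" if "x \<in> P" "y \<in> P" for x y
    using P that unfolding prime_filter_def lattice_filter_def by blast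
  have prime: "x \<in> P \<or> y \<in> P" if "rl_join A x y \<in> P" "x \<in> carrier A" "y \<in> carrier A" for x y
    using P that unfolding prime_filter_def by blast
  define E where "E x q \<longleftrightarrow> rl_eq A x (rl_const A q z) \<in> P" for x q
  have "\<exists>q. E x q" if x: "x \<in> carrier A" for x
  proof -
    have c: "rl_eq A x (rl_const A q z) \<in> carrier A" for q
      using x zc by (intro rl_eq_closed rl_const_closed)
    have "rl_join A z (rl_join A
        (rl_join A (rl_eq A x (rl_const A Bot z)) (rl_eq A x (rl_const A Cc z)))
        (rl_join A (rl_eq A x (rl_const A Ee z)) (rl_eq A x (rl_const A Cs z)))) \<in> P"
      using rl_const_cover[OF x ab] one by (simp add: z_def del: rl_const.simps)
    thus ?thesis
      unfolding E_def using prime z zc c join_closed by meson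
  qed
  moreover have "p = q" if "x \<in> carrier A" "E x p" "E x q" for x p q
  proof (rule ccontr)
    assume "p \<noteq> q"
    hence "rl_meet A (rl_eq A x (rl_const A p z)) (rl_eq A x (rl_const A q z)) \<preceq> z"
      using rl_const_distinct[OF that(1) ab] by (simp add: z_def)
    thus False
      using up[OF meet] that z zc unfolding E_def by blast
  qed
  ultimately obtain h where h: "\<And>x q. x \<in> carrier A \<Longrightarrow> h x = q \<longleftrightarrow> E x q"
    by metis
  \<comment> \<open>By the choice of \<open>h\<close>, both equality terms in the meet lie in
    \<open>P\<close>, hence so does everything above their meet.\<close>
  have op: "rl_eq A u v \<in> P"
    if "x \<in> carrier A" "y \<in> carrier A" "u \<in> carrier A" "v \<in> carrier A"
      "rl_meet A (rl_eq A x (rl_const A (h x) z)) (rl_eq A y (rl_const A (h y) z)) \<preceq> rl_eq A u v"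
    for x y u v
    using up[OF meet rl_eq_closed] h that unfolding E_def by blast
  have "h \<in> rl_hom A C4"
    unfolding rl_hom_def hom_def
  proof (intro CollectI conjI ballI)
    show "h \<one>\<^bsub>A\<^esub> = \<one>\<^bsub>C4\<^esub>"
      using h[of "\<one>\<^bsub>A\<^esub>" Ee] one by (simp add: E_def rl_eq_self)
  next
    fix x y assume xy: "x \<in> carrier A" "y \<in> carrier A"
    note cl = xy zc rl_const_closed closed
    note cong = rl_eq_cong[OF xy rl_const_closed[OF zc, of "h x"] rl_const_closed[OF zc, of "h y"]]
    note ops = rl_const_ops[OF ab, folded z_def]
    show "h (x \<otimes>\<^bsub>A\<^esub> y) = h x \<otimes>\<^bsub>C4\<^esub> h y"
      using op[OF xy _ _ cong(3)] cl by (simp add: h E_def ops del: rl_const.simps)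
    show "h (rl_meet A x y) = rl_meet C4 (h x) (h y)"
      using op[OF xy _ _ cong(1)] cl by (simp add: h E_def ops del: rl_const.simps)
    show "h (rl_join A x y) = rl_join C4 (h x) (h y)"
      using op[OF xy _ _ cong(2)] cl by (simp add: h E_def ops del: rl_const.simps)
    show "h (rl_under A x y) = rl_under C4 (h x) (h y)"
      using op[OF xy _ _ cong(4)] cl by (simp add: h E_def ops del: rl_const.simps)
    show "h (rl_over A x y) = rl_over C4 (h x) (h y)"
      using op[OF xy _ _ cong(5)] cl by (simp add: h E_def ops del: rl_const.simps)
  qed auto
  thus ?thesis
    using that h unfolding E_def by simp
qed

end

lemma C4_variety_memberI: "A \<in> variety_generated_by C4 \<Longrightarrow> C4_variety_member A"
  by (simp add: C4_variety_member_def C4_variety_member_axioms_def variety_generated_by_def)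

section \<open>Homomorphisms into the four-element chain\<close>

lemma rl_homD:
  assumes "h \<in> rl_hom A B"
  shows "h \<one>\<^bsub>A\<^esub> = \<one>\<^bsub>B\<^esub>"
    and "x \<in> carrier A \<Longrightarrow> h x \<in> carrier B"
    and "\<lbrakk>x \<in> carrier A; y \<in> carrier A\<rbrakk> \<Longrightarrow> h (x \<otimes>\<^bsub>A\<^esub> y) = h x \<otimes>\<^bsub>B\<^esub> h y"
    and "\<lbrakk>x \<in> carrier A; y \<in> carrier A\<rbrakk> \<Longrightarrow> h (rl_meet A x y) = rl_meet B (h x) (h y)"
    and "\<lbrakk>x \<in> carrier A; y \<in> carrier A\<rbrakk> \<Longrightarrow> h (rl_join A x y) = rl_join B (h x) (h y)"
    and "\<lbrakk>x \<in> carrier A; y \<in> carrier A\<rbrakk> \<Longrightarrow> h (rl_under A x y) = rl_under B (h x) (h y)"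
    and "\<lbrakk>x \<in> carrier A; y \<in> carrier A\<rbrakk> \<Longrightarrow> h (rl_over A x y) = rl_over B (h x) (h y)"
  using assms by (auto simp: rl_hom_def hom_def)

lemma rl_hom_compose: "f \<in> rl_hom A B \<Longrightarrow> g \<in> rl_hom B C \<Longrightarrow> g \<circ> f \<in> rl_hom A C"
  by (auto simp: rl_hom_def hom_def Pi_iff)

lemma (in residuated_lattice) hom_rl_eq:
  assumes "h \<in> rl_hom A B" "x \<in> carrier A" "y \<in> carrier A"
  shows "h (rl_eq A x y) = rl_eq B (h x) (h y)"
  using assms(2,3)
  by (simp add: rl_eq_def Let_def rl_homD[OF assms(1)] meet_closed under_closed)

lemma (in residuated_lattice) hom_rl_const:
  assumes "h \<in> rl_hom A B" "z \<in> carrier A"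
  shows "h (rl_const A q z) = rl_const B q (h z)"
  using assms(2) by (cases q) (simp_all add: rl_homD[OF assms(1)] under_closed)

lemma trivial_hom_C4: "(\<lambda>_. Ee) \<in> rl_hom A C4"
  by (simp add: rl_hom_def hom_def)

context C4_variety_member
begin

text \<open>Since \<open>z\<close> lies strictly below the unit, some prime filter contains the unit
  but not \<open>z\<close>. The resulting homomorphism sends the equality term of \<open>a\<close>
  and \<open>b\<close> to \<open>Bot\<close>.\<close>

lemma hom_C4_separates:
  assumes "a \<in> carrier A" "b \<in> carrier A" "a \<noteq> b"
  obtains h where "h \<in> rl_hom A C4" "h a \<noteq> h b"
proof -
  define z where "z = rl_eq A a b"
  have zc: "z \<in> carrier A" and z1: "z \<noteq> \<one>\<^bsub>A\<^esub>"
    using assms rl_eq_closed eq_if_rl_eq_one unfolding z_def by auto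
  have "z \<preceq> \<one>\<^bsub>A\<^esub>"
    using inequality4[OF assms(1,2,2,2), of "eq_term (Var 0) (Var 1)" One]
    by (simp add: rl_eq_C4 z_def)
  hence notle: "\<not> \<one>\<^bsub>A\<^esub> \<preceq> z"
    using le_antisym z1 zc by blast
  have "lattice_filter {x \<in> carrier A. \<one>\<^bsub>A\<^esub> \<preceq> x}"
    unfolding lattice_filter_def
    by (auto intro: le_refl le_meetI meet_closed le_trans[OF _ _ one_closed])
  moreover have "rl_join A z z = z"
    using zc le_iff_join le_refl by blast
  ultimately obtain P where P: "prime_filter P" "{x \<in> carrier A. \<one>\<^bsub>A\<^esub> \<preceq> x} \<subseteq> P" "P \<inter> {z} = {}"
    using prime_filter_exists[OF distrib, of "{x \<in> carrier A. \<one>\<^bsub>A\<^esub> \<preceq> x}" "{z}"] zc notle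
    by auto
  hence one: "\<one>\<^bsub>A\<^esub> \<in> P"
    using le_refl by auto
  obtain h where h: "h \<in> rl_hom A C4"
    and hq: "\<And>x q. x \<in> carrier A \<Longrightarrow> h x = q \<longleftrightarrow> rl_eq A x (rl_const A q z) \<in> P"
    using hom_of_prime_filter[OF P(1) one assms(1,2)] P(3) unfolding z_def by auto
  have "h z = Bot"
    using hq[OF zc, of Bot] zc one by (simp add: rl_eq_self)
  moreover have "h z = rl_eq C4 (h a) (h b)"
    unfolding z_def using hom_rl_eq h assms by blast
  ultimately have "h a \<noteq> h b"
    by (auto simp: rl_eq_C4)
  thus ?thesis
    using that h by blast
qed

end

text \<open>\<open>h\<close> is determined by the elements it sends to \<open>Ee\<close> or above,
  once some \<open>z\<close> has value \<open>Bot\<close>. So it suffices to find a prime filter of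
  \<open>B\<close> that induces this set on the image of \<open>A\<close>.\<close>

lemma hom_C4_extends:
  assumes A: "A \<in> variety_generated_by C4" and B: "B \<in> variety_generated_by C4"
    and i: "i \<in> rl_embedding A B" and h: "h \<in> rl_hom A C4"
  obtains k where "k \<in> rl_hom B C4" "\<And>x. x \<in> carrier A \<Longrightarrow> k (i x) = h x"
\<comment> \<open>A constant \<open>h\<close> admits no \<open>z\<close> with value
  \<open>Bot\<close>, but it extends trivially.\<close>
proof (cases "\<forall>x\<in>carrier A. h x = Ee")
  case True
  thus ?thesis
    using that trivial_hom_C4 by auto
next
  case False
  then obtain w where w: "w \<in> carrier A" "h w \<noteq> Ee"
    by blast
  interpret A: C4_variety_member A
    using A by (rule C4_variety_memberI)
  interpret B: C4_variety_member B
    using B by (rule C4_variety_memberI)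
  have ih: "i \<in> rl_hom A B" and inj: "inj_on i (carrier A)"
    using i by (auto simp: rl_embedding_def)
  note iD = rl_homD[OF ih] and hD = rl_homD[OF h, simplified]
  have i_le: "A.le x y" if "B.le (i x) (i y)" "x \<in> carrier A" "y \<in> carrier A" for x y
    using that inj iD(4)[of x y] A.meet_closed unfolding rl_le_def inj_on_def by metis
  have h_mono: "h x \<le> h y" if "A.le x y" "x \<in> carrier A" "y \<in> carrier A" for x y
    using that hD(4)[of x y] unfolding rl_le_def by (metis min.absorb_iff1)
  \<comment> \<open>\<open>F\<close> and \<open>J\<close> force the prime filter to contain
    \<open>i x\<close> if \<open>h x\<close> is at least \<open>Ee\<close>, and to omit it
    otherwise.\<close>
  define F where "F = {u \<in> carrier B. \<exists>x\<in>carrier A. Ee \<le> h x \<and> B.le (i x) u}"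
  define J where "J = i ` {x \<in> carrier A. h x < Ee}"
  have "B.lattice_filter F"
    unfolding B.lattice_filter_def
  proof (intro conjI ballI impI)
    show "F \<subseteq> carrier B" "F \<noteq> {}"
      unfolding F_def using iD(1) hD(1) B.le_refl[of "\<one>\<^bsub>B\<^esub>"]
      by (auto intro!: exI[of _ "\<one>\<^bsub>B\<^esub>"] bexI[of _ "\<one>\<^bsub>A\<^esub>"])
  next
    fix u v assume "u \<in> F" "v \<in> F"
    then obtain x y where xy: "x \<in> carrier A" "y \<in> carrier A" "Ee \<le> h x" "Ee \<le> h y"
      "B.le (i x) u" "B.le (i y) v" and uv: "u \<in> carrier B" "v \<in> carrier B"
      unfolding F_def by blast
    have ixy: "i x \<in> carrier B" "i y \<in> carrier B" "rl_meet B (i x) (i y) \<in> carrier B"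
      using xy iD(2) B.meet_closed by auto
    have "B.le (rl_meet B (i x) (i y)) u" "B.le (rl_meet B (i x) (i y)) v"
      using ixy xy uv B.meet_le1 B.meet_le2 B.le_trans by metis+
    hence "B.le (i (rl_meet A x y)) (rl_meet B u v)"
      using ixy xy uv by (simp add: iD B.le_meetI)
    thus "rl_meet B u v \<in> F"
      unfolding F_def using xy uv hD(4) A.meet_closed B.meet_closed
      by (auto intro!: bexI[of _ "rl_meet A x y"])
  next
    fix u v assume "u \<in> F" "v \<in> carrier B" "B.le u v"
    thus "v \<in> F"
      unfolding F_def using iD(2) B.le_trans by blast
  qed
  moreover have "J \<subseteq> carrier B"
    unfolding J_def using iD(2) by blast
  moreover have "F \<inter> J = {}"
    unfolding F_def J_def using i_le h_mono by fastforce
  moreover have "rl_join B u v \<in> J" if uv: "u \<in> J" "v \<in> J" for u v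
  proof -
    obtain x y where xy: "x \<in> carrier A" "y \<in> carrier A" "h x < Ee" "h y < Ee" "u = i x" "v = i y"
      using uv unfolding J_def by blast
    have "rl_join B u v = i (rl_join A x y)" "h (rl_join A x y) < Ee" "rl_join A x y \<in> carrier A"
      using xy iD(5) hD(5) A.join_closed by auto
    thus ?thesis
      unfolding J_def by blast
  qed
  ultimately obtain P where P: "B.prime_filter P" "F \<subseteq> P" "P \<inter> J = {}"
    using B.prime_filter_exists[OF B.distrib, of F J] by blast
  have iP: "i x \<in> P \<longleftrightarrow> Ee \<le> h x" if "x \<in> carrier A" for x
  proof
    assume "i x \<in> P"
    thus "Ee \<le> h x"
      using P(3) that unfolding J_def by force
  next
    assume "Ee \<le> h x"
    hence "i x \<in> F"
      unfolding F_def using that iD(2) B.le_refl by blast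
    thus "i x \<in> P"
      using P(2) by blast
  qed
  \<comment> \<open>As \<open>h w\<close> differs from \<open>Ee\<close>, \<open>z\<close> has value
    \<open>Bot\<close> under \<open>h\<close>, and its image under \<open>i\<close> is again an
    equality term.\<close>
  define z where "z = rl_eq A w \<one>\<^bsub>A\<^esub>"
  have zc: "z \<in> carrier A"
    unfolding z_def using w by (intro A.rl_eq_closed) auto
  have hz: "h z = Bot"
    using w A.hom_rl_eq[OF h, of w "\<one>\<^bsub>A\<^esub>"] hD(1) by (simp add: z_def rl_eq_C4)
  have iz: "i z = rl_eq B (i w) \<one>\<^bsub>B\<^esub>"
    using w A.hom_rl_eq[OF ih, of w "\<one>\<^bsub>A\<^esub>"] iD(1) by (simp add: z_def)
  have "\<one>\<^bsub>B\<^esub> \<in> P" "i z \<notin> P"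
    using iP[of "\<one>\<^bsub>A\<^esub>"] iP[OF zc] iD(1) hD(1) hz by auto
  then obtain k where k: "k \<in> rl_hom B C4"
    and kq: "\<And>x q. x \<in> carrier B \<Longrightarrow> k x = q \<longleftrightarrow> rl_eq B x (rl_const B q (i z)) \<in> P"
    using B.hom_of_prime_filter[OF P(1), of "i w" "\<one>\<^bsub>B\<^esub>"] w iD(2) iz by auto
  have "k (i x) = h x" if x: "x \<in> carrier A" for x
  proof -
    \<comment> \<open>At \<open>z\<close> the constant for \<open>h x\<close> has value
      \<open>h x\<close> under \<open>h\<close>, so \<open>?y\<close> is sent to \<open>Ee\<close>
      and its image lies in \<open>P\<close>.\<close>
    let ?y = "rl_eq A x (rl_const A (h x) z)"
    have yc: "rl_const A (h x) z \<in> carrier A" "?y \<in> carrier A"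
      using x zc A.rl_const_closed A.rl_eq_closed by auto
    have "h ?y = Ee"
      using x zc yc hz A.hom_rl_eq[OF h] A.hom_rl_const[OF h] by (simp add: rl_eq_C4 rl_const_C4)
    hence "i ?y \<in> P"
      using iP yc by simp
    hence "rl_eq B (i x) (rl_const B (h x) (i z)) \<in> P"
      using x zc yc A.hom_rl_eq[OF ih] A.hom_rl_const[OF ih] by simp
    thus ?thesis
      using kq iD(2) x by blast
  qed
  thus ?thesis
    using that k by blast
qed

section \<open>Algebras with separating homomorphisms into the chain\<close>

lemma (in residuated_lattice) eval_closed:
  "range v \<subseteq> carrier A \<Longrightarrow> rl_eval A v t \<in> carrier A"
  by (induction t) (auto simp: meet_closed join_closed under_closed over_closed)

lemma (in residuated_lattice) hom_eval:
  assumes "h \<in> rl_hom A B" "range v \<subseteq> carrier A"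
  shows "h (rl_eval A v t) = rl_eval B (h \<circ> v) t"
  by (induction t) (simp_all add: rl_homD[OF assms(1)] eval_closed[OF assms(2)])

text \<open>The homomorphisms play the part of the coordinates of a power of \<open>B\<close>:
  identities hold because they hold in every coordinate.\<close>

lemma in_variety_if_homs_separate:
  assumes closed: "\<one>\<^bsub>A\<^esub> \<in> carrier A"
    "\<And>x y. \<lbrakk>x \<in> carrier A; y \<in> carrier A\<rbrakk> \<Longrightarrow> x \<otimes>\<^bsub>A\<^esub> y \<in> carrier A"
    "\<And>x y. \<lbrakk>x \<in> carrier A; y \<in> carrier A\<rbrakk> \<Longrightarrow> rl_meet A x y \<in> carrier A"
    "\<And>x y. \<lbrakk>x \<in> carrier A; y \<in> carrier A\<rbrakk> \<Longrightarrow> rl_join A x y \<in> carrier A"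
    "\<And>x y. \<lbrakk>x \<in> carrier A; y \<in> carrier A\<rbrakk> \<Longrightarrow> rl_under A x y \<in> carrier A"
    "\<And>x y. \<lbrakk>x \<in> carrier A; y \<in> carrier A\<rbrakk> \<Longrightarrow> rl_over A x y \<in> carrier A"
    and H: "\<And>i. i \<in> I \<Longrightarrow> H i \<in> rl_hom A B"
    and sep: "\<And>x y. \<lbrakk>x \<in> carrier A; y \<in> carrier A; \<And>i. i \<in> I \<Longrightarrow> H i x = H i y\<rbrakk> \<Longrightarrow> x = y"
    and B: "residuated_lattice B"
  shows "A \<in> variety_generated_by B"
proof -
  interpret B: residuated_lattice B by fact
  note D = rl_homD[OF H]
  \<comment> \<open>Residuation is not an equation, but the order is coordinatewise.\<close>
  have le: "rl_le A x y \<longleftrightarrow> (\<forall>i\<in>I. rl_le B (H i x) (H i y))"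
    if "x \<in> carrier A" "y \<in> carrier A" for x y
    using that sep[of "rl_meet A x y" x] closed(3) unfolding rl_le_def
    by (metis D(4))
  have A: "residuated_lattice A"
  proof unfold_locales
    fix a b c assume a: "a \<in> carrier A" and b: "b \<in> carrier A" and c: "c \<in> carrier A"
    note s = a b c closed
    show "a \<otimes>\<^bsub>A\<^esub> b \<otimes>\<^bsub>A\<^esub> c = a \<otimes>\<^bsub>A\<^esub> (b \<otimes>\<^bsub>A\<^esub> c)"
      by (rule sep) (simp_all add: s D B.m_assoc)
    show "rl_meet A (rl_meet A a b) c = rl_meet A a (rl_meet A b c)"
      by (rule sep) (simp_all add: s D B.meet_assoc)
    show "rl_join A (rl_join A a b) c = rl_join A a (rl_join A b c)"
      by (rule sep) (simp_all add: s D B.join_assoc)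
    show "rl_le A b (rl_under A a c) \<longleftrightarrow> rl_le A (a \<otimes>\<^bsub>A\<^esub> b) c"
      by (simp add: s le D B.under_residual)
    show "rl_le A (a \<otimes>\<^bsub>A\<^esub> b) c \<longleftrightarrow> rl_le A a (rl_over A c b)"
      by (simp add: s le D B.over_residual)
  next
    fix a b assume a: "a \<in> carrier A" and b: "b \<in> carrier A"
    note s = a b closed
    show "rl_meet A a b = rl_meet A b a"
      by (rule sep) (simp_all add: s D B.meet_comm)
    show "rl_join A a b = rl_join A b a"
      by (rule sep) (simp_all add: s D B.join_comm)
    show "rl_meet A a (rl_join A a b) = a"
      by (rule sep) (simp_all add: s D B.meet_join_absorb)
    show "rl_join A a (rl_meet A a b) = a"
      by (rule sep) (simp_all add: s D B.join_meet_absorb)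
  next
    fix a assume a: "a \<in> carrier A"
    show "\<one>\<^bsub>A\<^esub> \<otimes>\<^bsub>A\<^esub> a = a" "a \<otimes>\<^bsub>A\<^esub> \<one>\<^bsub>A\<^esub> = a"
      by (rule sep; simp add: a closed D)+
  qed (simp_all add: closed)
  interpret residuated_lattice A by fact
  have "rl_models A E" if "rl_models B E" for E
    unfolding rl_models_def
  proof (clarify)
    fix s t and v :: "nat \<Rightarrow> 'a"
    assume st: "(s, t) \<in> E" and v: "range v \<subseteq> carrier A"
    show "rl_eval A v s = rl_eval A v t"
    proof (rule sep)
      fix i assume i: "i \<in> I"
      have "range (H i \<circ> v) \<subseteq> carrier B"
        using v D(2)[OF i] by auto
      thus "H i (rl_eval A v s) = H i (rl_eval A v t)"
        using that st by (auto simp: hom_eval[OF H[OF i] v] rl_models_def)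
    qed (use eval_closed v in blast)+
  qed
  thus ?thesis
    using A by (simp add: variety_generated_by_def)
qed

section \<open>Subalgebras of powers of the chain on an infinite type\<close>

text \<open>\<open>p\<close> is a pairing function and \<open>c\<close> supplies constructor tags.
  \<open>One\<close> is padded with a dummy second component, so that every code is a pair headed by
  its tag.\<close>

primrec encode_term :: "(nat \<Rightarrow> 'u) \<Rightarrow> ('u \<Rightarrow> 'u \<Rightarrow> 'u) \<Rightarrow> ('v \<Rightarrow> 'u) \<Rightarrow> 'v rl_term \<Rightarrow> 'u" where
  "encode_term c p f (Var x) = p (c 0) (f x)"
| "encode_term c p f One = p (c 1) (c 0)"
| "encode_term c p f (Meet s t) = p (c 2) (p (encode_term c p f s) (encode_term c p f t))"
| "encode_term c p f (Join s t) = p (c 3) (p (encode_term c p f s) (encode_term c p f t))"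
| "encode_term c p f (Mult s t) = p (c 4) (p (encode_term c p f s) (encode_term c p f t))"
| "encode_term c p f (Under s t) = p (c 5) (p (encode_term c p f s) (encode_term c p f t))"
| "encode_term c p f (Over s t) = p (c 6) (p (encode_term c p f s) (encode_term c p f t))"

lemma inj_encode_term:
  assumes "inj c" "inj f" "\<And>a b a' b'. p a b = p a' b' \<longleftrightarrow> a = a' \<and> b = b'"
  shows "inj (encode_term c p f)"
proof
  have c: "c m = c n \<longleftrightarrow> m = n" for m n
    using assms(1) by (auto dest: injD)
  show "s = t" if "encode_term c p f s = encode_term c p f t" for s t
    using that
  proof (induction s arbitrary: t)
    case (Var x)
    thus ?case using assms(2) by (cases t) (auto simp: c assms(3) dest: injD)
  next
    case One
    thus ?case by (cases t) (auto simp: c assms(3))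
  next
    case (Meet s1 s2)
    thus ?case by (cases t) (auto simp: c assms(3))
  next
    case (Join s1 s2)
    thus ?case by (cases t) (auto simp: c assms(3))
  next
    case (Mult s1 s2)
    thus ?case by (cases t) (auto simp: c assms(3))
  next
    case (Under s1 s2)
    thus ?case by (cases t) (auto simp: c assms(3))
  next
    case (Over s1 s2)
    thus ?case by (cases t) (auto simp: c assms(3))
  qed
qed

text \<open>An infinite type is equinumerous with its square, which gives the pairing. Tagged pairs
  also embed the sum of two copies.\<close>

lemma infinite_type_encodes_terms:
  assumes "infinite (UNIV :: 'u set)"
  obtains f :: "('u + 'u) rl_term \<Rightarrow> 'u" where "inj f"
proof -
  obtain c :: "nat \<Rightarrow> 'u" where c: "inj c"
    using infinite_countable_subset[OF assms] by blast
  have "\<exists>g :: 'u \<times> 'u \<Rightarrow> 'u. bij_betw g (UNIV \<times> UNIV) UNIV"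
    using card_of_Times_same_infinite[OF assms] card_of_ordIso by blast
  then obtain g :: "'u \<times> 'u \<Rightarrow> 'u" where "inj g"
    by (auto simp: bij_betw_def)
  define p where "p = curry g"
  have p: "p a b = p a' b' \<longleftrightarrow> a = a' \<and> b = b'" for a b a' b'
    using \<open>inj g\<close> by (auto simp: p_def dest: injD)
  have "inj (case_sum (p (c 0)) (p (c 1)) :: 'u + 'u \<Rightarrow> 'u)"
    using c by (auto intro!: injI simp: p split: sum.splits dest: injD)
  from inj_encode_term[OF c this p] show ?thesis
    using that by blast
qed

text \<open>The witness is the algebra of terms modulo equality under all valuations in \<open>W\<close>, that is,
  the subalgebra of the power \<open>C4\<^sup>W\<close> generated by the projections.\<close>

lemma term_algebra_in_variety:
  fixes W :: "('v \<Rightarrow> c4) set" and f :: "'v rl_term \<Rightarrow> 'u"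
  assumes "inj f"
  obtains D :: "'u rl_algebra" and cl where "D \<in> variety_generated_by C4" "range cl \<subseteq> carrier D"
    and "\<And>s t. cl s = cl t \<longleftrightarrow> (\<forall>w\<in>W. rl_eval C4 w s = rl_eval C4 w t)"
    and "cl One = \<one>\<^bsub>D\<^esub>"
    and "\<And>s t. cl (Mult s t) = cl s \<otimes>\<^bsub>D\<^esub> cl t"
    and "\<And>s t. cl (Meet s t) = rl_meet D (cl s) (cl t)"
    and "\<And>s t. cl (Join s t) = rl_join D (cl s) (cl t)"
    and "\<And>s t. cl (Under s t) = rl_under D (cl s) (cl t)"
    and "\<And>s t. cl (Over s t) = rl_over D (cl s) (cl t)"
proof -
  define R where "R s t \<longleftrightarrow> (\<forall>w\<in>W. rl_eval C4 w s = rl_eval C4 w t)" for s t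
  \<comment> \<open>The class of a term is represented by the code of a chosen member, so the
    quotient lives on \<open>'u\<close>.\<close>
  define cl where "cl t = f (SOME s. R s t)" for t
  have R_some: "R (SOME s. R s t) t" for t
    by (rule someI[of _ t]) (simp add: R_def)
  have cl_iff: "cl s = cl t \<longleftrightarrow> R s t" for s t
  proof
    assume "cl s = cl t"
    hence "(SOME r. R r s) = (SOME r. R r t)"
      using assms by (auto simp: cl_def dest: injD)
    thus "R s t"
      using R_some[of s] R_some[of t] by (auto simp: R_def)
  next
    assume "R s t"
    hence "(\<lambda>r. R r s) = (\<lambda>r. R r t)"
      by (auto simp: R_def)
    thus "cl s = cl t"
      by (simp add: cl_def)
  qed
  define rep where "rep u = (SOME t. cl t = u)" for u
  have rep: "cl (rep (cl t)) = cl t" for t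
    unfolding rep_def by (rule someI[of _ t]) simp
  hence eval_rep: "rl_eval C4 w (rep (cl t)) = rl_eval C4 w t" if "w \<in> W" for w t
    using that cl_iff R_def by blast
  define D where "D = \<lparr>carrier = range cl, mult = (\<lambda>x y. cl (Mult (rep x) (rep y))), one = cl One,
    rl_meet = (\<lambda>x y. cl (Meet (rep x) (rep y))), rl_join = (\<lambda>x y. cl (Join (rep x) (rep y))),
    rl_under = (\<lambda>x y. cl (Under (rep x) (rep y))), rl_over = (\<lambda>x y. cl (Over (rep x) (rep y)))\<rparr>"
  \<comment> \<open>Each valuation in \<open>W\<close> acts as a coordinate projection; by
    \<open>eval_rep\<close> the choice of representative does not matter.\<close>
  have hom: "(\<lambda>u. rl_eval C4 w (rep u)) \<in> rl_hom D C4" if "w \<in> W" for w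
    using that by (auto simp: rl_hom_def hom_def D_def eval_rep)
  have "D \<in> variety_generated_by C4"
  proof (rule in_variety_if_homs_separate[OF _ _ _ _ _ _ hom _ residuated_lattice_C4])
    fix x y assume xy: "x \<in> carrier D" "y \<in> carrier D"
      "\<And>w. w \<in> W \<Longrightarrow> rl_eval C4 w (rep x) = rl_eval C4 w (rep y)"
    then obtain s t where st: "x = cl s" "y = cl t"
      by (auto simp: D_def)
    have "rl_eval C4 w s = rl_eval C4 w t" if "w \<in> W" for w
      using xy(3)[OF that] by (simp add: st eval_rep that)
    thus "x = y"
      by (simp add: st cl_iff R_def)
  qed (auto simp: D_def)
  thus ?thesis
    by (rule that[of D cl]) (auto simp: D_def cl_iff R_def eval_rep)
qed

theorem theorem6p8:
  assumes "infinite (UNIV :: 'u set)"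
  shows "amalgamation_property (variety_generated_by C4 :: 'u rl_algebra set)"
  unfolding amalgamation_property_def
proof (intro ballI)
  fix A B C :: "'u rl_algebra" and i1 i2
  assume V: "A \<in> variety_generated_by C4" "B \<in> variety_generated_by C4" "C \<in> variety_generated_by C4"
    and i: "i1 \<in> rl_embedding A B" "i2 \<in> rl_embedding A C"
  interpret B: C4_variety_member B using V(2) by (rule C4_variety_memberI)
  interpret C: C4_variety_member C using V(3) by (rule C4_variety_memberI)
  \<comment> \<open>The variables are all of \<open>'u + 'u\<close>; elements outside the carriers
    merely give further generators.\<close>
  define W where "W = {case_sum h k | h k. h \<in> rl_hom B C4 \<and> k \<in> rl_hom C C4 \<and>
    (\<forall>x\<in>carrier A. h (i1 x) = k (i2 x))}"
  obtain f :: "('u + 'u) rl_term \<Rightarrow> 'u" where "inj f"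
    using infinite_type_encodes_terms[OF assms] by blast
  then obtain D :: "'u rl_algebra" and cl where D: "D \<in> variety_generated_by C4" "range cl \<subseteq> carrier D"
    and cl: "\<And>s t. cl s = cl t \<longleftrightarrow> (\<forall>w\<in>W. rl_eval C4 w s = rl_eval C4 w t)"
    and cl_ops: "cl One = \<one>\<^bsub>D\<^esub>"
      "\<And>s t. cl (Mult s t) = cl s \<otimes>\<^bsub>D\<^esub> cl t"
      "\<And>s t. cl (Meet s t) = rl_meet D (cl s) (cl t)"
      "\<And>s t. cl (Join s t) = rl_join D (cl s) (cl t)"
      "\<And>s t. cl (Under s t) = rl_under D (cl s) (cl t)"
      "\<And>s t. cl (Over s t) = rl_over D (cl s) (cl t)"
    using term_algebra_in_variety[of f W] by blast
  \<comment> \<open>Equality of classes is tested by the valuations in \<open>W\<close>, so only the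
    composites \<open>w \<circ> j\<close> need to be homomorphisms.\<close>
  have hom: "(\<lambda>b. cl (Var (j b))) \<in> rl_hom E D"
    if "\<And>w. w \<in> W \<Longrightarrow> w \<circ> j \<in> rl_hom E C4" for j and E :: "'u rl_algebra"
    using D(2) rl_homD[OF that] unfolding rl_hom_def hom_def
    by (auto simp: cl simp flip: cl_ops)
  have 1: "(\<lambda>b. cl (Var (Inl b))) \<in> rl_embedding B D"
    unfolding rl_embedding_def
  proof (intro CollectI conjI hom inj_onI)
    show "w \<circ> Inl \<in> rl_hom B C4" if "w \<in> W" for w
      using that by (auto simp: W_def o_def)
    fix x y assume xy: "x \<in> carrier B" "y \<in> carrier B" "cl (Var (Inl x)) = cl (Var (Inl y))"
    show "x = y"
    proof (rule ccontr)
      assume "x \<noteq> y"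
      then obtain h where h: "h \<in> rl_hom B C4" "h x \<noteq> h y"
        using B.hom_C4_separates xy by blast
      \<comment> \<open>Extending this restriction of \<open>h\<close> along \<open>i2\<close>
        supplies the partner \<open>k\<close> that places the separating \<open>h\<close> in a
        member of \<open>W\<close>.\<close>
      have "h \<circ> i1 \<in> rl_hom A C4"
        using i(1) h(1) rl_hom_compose by (auto simp: rl_embedding_def)
      from hom_C4_extends[OF V(1,3) i(2) this]
      obtain k where "k \<in> rl_hom C C4" "\<forall>a\<in>carrier A. h (i1 a) = k (i2 a)"
        by (metis comp_apply)
      hence "case_sum h k \<in> W"
        using h(1) unfolding W_def by blast
      hence "rl_eval C4 (case_sum h k) (Var (Inl x)) = rl_eval C4 (case_sum h k) (Var (Inl y))"
        using xy(3) unfolding cl by blast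
      thus False
        using h(2) by simp
    qed
  qed
  have 2: "(\<lambda>c. cl (Var (Inr c))) \<in> rl_embedding C D"
    unfolding rl_embedding_def
  proof (intro CollectI conjI hom inj_onI)
    show "w \<circ> Inr \<in> rl_hom C C4" if "w \<in> W" for w
      using that by (auto simp: W_def o_def)
    fix x y assume xy: "x \<in> carrier C" "y \<in> carrier C" "cl (Var (Inr x)) = cl (Var (Inr y))"
    show "x = y"
    proof (rule ccontr)
      assume "x \<noteq> y"
      then obtain k where k: "k \<in> rl_hom C C4" "k x \<noteq> k y"
        using C.hom_C4_separates xy by blast
      have "k \<circ> i2 \<in> rl_hom A C4"
        using i(2) k(1) rl_hom_compose by (auto simp: rl_embedding_def)
      from hom_C4_extends[OF V(1,2) i(1) this]
      obtain h where "h \<in> rl_hom B C4" "\<forall>a\<in>carrier A. h (i1 a) = k (i2 a)"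
        by (metis comp_apply)
      hence "case_sum h k \<in> W"
        using k(1) unfolding W_def by blast
      hence "rl_eval C4 (case_sum h k) (Var (Inr x)) = rl_eval C4 (case_sum h k) (Var (Inr y))"
        using xy(3) unfolding cl by blast
      thus False
        using k(2) by simp
    qed
  qed
  have "\<forall>x\<in>carrier A. cl (Var (Inl (i1 x))) = cl (Var (Inr (i2 x)))"
    by (auto simp: cl W_def)
  thus "\<exists>D\<in>variety_generated_by C4 :: 'u rl_algebra set. \<exists>j1\<in>rl_embedding B D.
      \<exists>j2\<in>rl_embedding C D. \<forall>x\<in>carrier A. j1 (i1 x) = j2 (i2 x)"
    by (intro bexI[OF _ 1] bexI[OF _ 2] bexI[OF _ D(1)])
qed

end
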